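(* Let $\gamma\ge 0$ and let $\delta\in(0,1)$ be a constant. Unless there is a $(\gamma,\delta)$-MPC algorithm which, in $o(\log n)$ parallel time, distinguishes between the two instances (1) a single cycle on $n$ vertices and (2) two disjoint cycles each on $n/2$ vertices, every $(\gamma,\delta)$-MPC algorithm requires $\Omega(\log D')$ parallel time for testing whether a graph $G$ with constant diameter is biconnected, where $D'=\operatorname{bidiam}(G)$.
   Context: A sequence $(v_1,\dots,v_k)$ with $v_1=v_k$ and consecutive vertices adjacent is a cycle of length $k-1$; it is simple if $k\ge4$ and all vertices except $v_1=v_k$ are distinct. For distinct vertices $u,v$, $\operatorname{cyclen}_G(u,v)$ is the minimum length of a simple cycle containing both ($\infty$ if none), $\operatorname{cyclen}_G(u,u)=0$, and $\operatorname{bidiam}(G)=\max\{\operatorname{cyclen}_G(u,v):\operatorname{cyclen}_G(u,v)<\infty\}$. Edges $e,e'$ are in the same biconnected component iff $e=e'$ or some simple cycle contains both; $G$ is biconnected when all its edges form a single biconnected component (equivalently, it has no more than one biconnected component). The diameter of $G$ is the maximum finite shortest-path distance between two vertices. The $(\gamma,\delta)$-MPC model: input size $N$; $p$ machines each with local memory $s=\Theta(N^{\delta})$ words, $p\cdot s=\Theta(N^{1+\gamma})$, words of $\Theta(\log(sp))$ bits; input initially distributed over $\Theta(N/s)$ machines; computation proceeds in rounds of arbitrary local computation followed by communication in which each machine sends and receives at most $s$ words; parallel time is the number of rounds. *)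

theory Defs
  imports "HOL-Library.Landau_Symbols" "HOL-Library.Extended_Nat" Complex_Main
begin

type_synonym 'a ugraph = "'a set \<times> 'a set set"

abbreviation verts :: "'a ugraph \<Rightarrow> 'a set" where "verts G \<equiv> fst G"
abbreviation edges :: "'a ugraph \<Rightarrow> 'a set set" where "edges G \<equiv> snd G"

definition ugraph :: "'a ugraph \<Rightarrow> bool" where
  "ugraph G \<longleftrightarrow> finite (verts G) \<and> verts G \<noteq> {} \<and>
     (\<forall>e\<in>edges G. \<exists>u v. e = {u, v} \<and> u \<noteq> v \<and> u \<in> verts G \<and> v \<in> verts G)"

text \<open>Walks and cycles are vertex sequences; a sequence of $k$ vertices has length $k - 1$.\<close>

definition walk :: "'a ugraph \<Rightarrow> 'a list \<Rightarrow> bool" where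
  "walk G c \<longleftrightarrow> c \<noteq> [] \<and> set c \<subseteq> verts G \<and>
     (\<forall>i. Suc i < length c \<longrightarrow> {c ! i, c ! Suc i} \<in> edges G)"

definition walk_edges :: "'a list \<Rightarrow> 'a set set" where
  "walk_edges c = {{c ! i, c ! Suc i} | i. Suc i < length c}"

definition simple_cycle :: "'a ugraph \<Rightarrow> 'a list \<Rightarrow> bool" where
  "simple_cycle G c \<longleftrightarrow> walk G c \<and> hd c = last c \<and> 4 \<le> length c \<and> distinct (tl c)"

definition gdist :: "'a ugraph \<Rightarrow> 'a \<Rightarrow> 'a \<Rightarrow> enat" where
  "gdist G u v = (INF c \<in> {c. walk G c \<and> hd c = u \<and> last c = v}. enat (length c - 1))"

definition diameter :: "'a ugraph \<Rightarrow> nat" where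
  "diameter G = Max {k. \<exists>u\<in>verts G. \<exists>v\<in>verts G. gdist G u v = enat k}"

definition cyclen :: "'a ugraph \<Rightarrow> 'a \<Rightarrow> 'a \<Rightarrow> enat" where
  "cyclen G u v = (if u = v then 0
     else INF c \<in> {c. simple_cycle G c \<and> u \<in> set c \<and> v \<in> set c}. enat (length c - 1))"

definition bidiam :: "'a ugraph \<Rightarrow> nat" where
  "bidiam G = Max {k. \<exists>u\<in>verts G. \<exists>v\<in>verts G. cyclen G u v = enat k}"

definition same_bicomponent :: "'a ugraph \<Rightarrow> 'a set \<Rightarrow> 'a set \<Rightarrow> bool" where
  "same_bicomponent G e e' \<longleftrightarrow>
     e = e' \<or> (\<exists>c. simple_cycle G c \<and> e \<in> walk_edges c \<and> e' \<in> walk_edges c)"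

definition biconnected :: "'a ugraph \<Rightarrow> bool" where
  "biconnected G \<longleftrightarrow> (\<forall>e\<in>edges G. \<forall>e'\<in>edges G. same_bicomponent G e e')"

definition one_cycle :: "nat \<Rightarrow> 'a ugraph \<Rightarrow> bool" where
  "one_cycle n G \<longleftrightarrow> card (verts G) = n \<and>
     (\<exists>c. simple_cycle G c \<and> verts G = set c \<and> edges G = walk_edges c)"

definition two_cycles :: "nat \<Rightarrow> 'a ugraph \<Rightarrow> bool" where
  "two_cycles n G \<longleftrightarrow>
     (\<exists>c c'. simple_cycle G c \<and> simple_cycle G c' \<and> set c \<inter> set c' = {} \<and>
        2 * card (set c) = n \<and> 2 * card (set c') = n \<and>
        verts G = set c \<union> set c' \<and> edges G = walk_edges c \<union> walk_edges c')"

text \<open>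
  Input graphs have vertices \<open>0, \<dots>, n - 1\<close>. The input is a sequence of two-word records, in
  arbitrary order: one record \<open>v v\<close> for each vertex \<open>v\<close>, and for each edge exactly one of
  the two records \<open>u v\<close>, \<open>v u\<close>. A graph with \<open>n\<close> vertices and \<open>m\<close> edges thus
  has input size $N = 2(n + m)$.
\<close>

definition input_graph :: "nat ugraph \<Rightarrow> bool" where
  "input_graph G \<longleftrightarrow> ugraph G \<and> (\<exists>n. verts G = {..<n})"

definition encodes :: "nat list \<Rightarrow> nat ugraph \<Rightarrow> bool" where
  "encodes xs G \<longleftrightarrow>
     (\<exists>ps. xs = concat (map (\<lambda>(u, v). [u, v]) ps) \<and>
        distinct (map (\<lambda>(u, v). {u, v}) ps) \<and>
        set (map (\<lambda>(u, v). {u, v}) ps) = (\<lambda>v. {v}) ` verts G \<union> edges G)"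

text \<open>
  All fields take the input size $N$ as first argument. Words are the numbers below
  $2^b$ for \<open>b = word_bits A N\<close>. In round \<open>r\<close>, machine \<open>i\<close> with local memory \<open>m\<close>
  computes \<open>compute A N r i m = (m', out)\<close>: it keeps \<open>m'\<close> and sends \<open>out j\<close> to machine \<open>j\<close>.
  There is no restriction on \<open>compute\<close>, in particular no uniformity in $N$.
  After \<open>r\<close> rounds, \<open>answer\<close> inspects the memory of machine 0 and either halts with a
  Boolean answer or continues. The input fills the machines in order with \<open>load A N\<close> words each.
\<close>

record mpc =
  memory :: "nat \<Rightarrow> nat"
  machines :: "nat \<Rightarrow> nat"
  word_bits :: "nat \<Rightarrow> nat"
  load :: "nat \<Rightarrow> nat"
  compute :: "nat \<Rightarrow> nat \<Rightarrow> nat \<Rightarrow> nat list \<Rightarrow> nat list \<times> (nat \<Rightarrow> nat list)"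
  answer :: "nat \<Rightarrow> nat \<Rightarrow> nat list \<Rightarrow> bool option"

text \<open>
  The last condition is not asymptotic: it excludes parameters for which inputs of some size
  do not fit, on which correctness would be vacuous.
\<close>

definition mpc_algorithm :: "real \<Rightarrow> real \<Rightarrow> mpc \<Rightarrow> bool" where
  "mpc_algorithm \<gamma> \<delta> A \<longleftrightarrow>
     (\<lambda>N. real (memory A N)) \<in> \<Theta>(\<lambda>N. real N powr \<delta>) \<and>
     (\<lambda>N. real (machines A N * memory A N)) \<in> \<Theta>(\<lambda>N. real N powr (1 + \<gamma>)) \<and>
     (\<lambda>N. real (word_bits A N)) \<in> \<Theta>(\<lambda>N. ln (real (memory A N * machines A N))) \<and>
     (\<lambda>N. real_of_int \<lceil>real N / real (load A N)\<rceil>) \<in> \<Theta>(\<lambda>N. real N / real (memory A N)) \<and>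
     (\<forall>N>0. 0 < load A N \<and> load A N \<le> memory A N \<and>
        N \<le> machines A N * load A N \<and> N \<le> 2 ^ word_bits A N)"

text \<open>
  \<open>config A xs r i\<close> is the memory of machine \<open>i\<close> after \<open>r\<close> rounds on input \<open>xs\<close>; received
  words are appended to the kept memory, ordered by sender.
\<close>

fun config :: "mpc \<Rightarrow> nat list \<Rightarrow> nat \<Rightarrow> nat \<Rightarrow> nat list" where
  "config A xs 0 i = take (load A (length xs)) (drop (i * load A (length xs)) xs)"
| "config A xs (Suc r) i =
     fst (compute A (length xs) r i (config A xs r i)) @
     concat (map (\<lambda>j. snd (compute A (length xs) r j (config A xs r j)) i)
       [0..<machines A (length xs)])"

definition msg :: "mpc \<Rightarrow> nat list \<Rightarrow> nat \<Rightarrow> nat \<Rightarrow> nat \<Rightarrow> nat list" where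
  "msg A xs r i j = snd (compute A (length xs) r i (config A xs r i)) j"

definition memory_ok :: "mpc \<Rightarrow> nat list \<Rightarrow> nat \<Rightarrow> bool" where
  "memory_ok A xs r \<longleftrightarrow>
     (\<forall>i < machines A (length xs). length (config A xs r i) \<le> memory A (length xs) \<and>
        (\<forall>w \<in> set (config A xs r i). w < 2 ^ word_bits A (length xs)))"

definition communication_ok :: "mpc \<Rightarrow> nat list \<Rightarrow> nat \<Rightarrow> bool" where
  "communication_ok A xs r \<longleftrightarrow>
     (\<forall>i < machines A (length xs).
        (\<Sum>j < machines A (length xs). length (msg A xs r i j)) \<le> memory A (length xs) \<and>
        (\<Sum>j < machines A (length xs). length (msg A xs r j i)) \<le> memory A (length xs))"

text \<open>On input \<open>xs\<close>, \<open>A\<close> respects the resource bounds and halts after exactly \<open>t\<close> rounds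
  with answer \<open>b\<close>.\<close>

definition halts :: "mpc \<Rightarrow> nat list \<Rightarrow> nat \<Rightarrow> bool \<Rightarrow> bool" where
  "halts A xs t b \<longleftrightarrow>
     answer A (length xs) t (config A xs t 0) = Some b \<and>
     (\<forall>r<t. answer A (length xs) r (config A xs r 0) = None) \<and>
     (\<forall>r\<le>t. memory_ok A xs r) \<and> (\<forall>r<t. communication_ok A xs r)"

definition distinguishes_cycles_in :: "mpc \<Rightarrow> (nat \<Rightarrow> real) \<Rightarrow> bool" where
  "distinguishes_cycles_in B T \<longleftrightarrow>
     (\<forall>n G xs. input_graph G \<and> (one_cycle n G \<or> two_cycles n G) \<and> encodes xs G \<longrightarrow>
        (\<exists>t. halts B xs t (one_cycle n G) \<and> real t \<le> T n))"

definition tests_biconnectivity :: "nat \<Rightarrow> mpc \<Rightarrow> bool" where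
  "tests_biconnectivity d A \<longleftrightarrow>
     (\<forall>G xs. input_graph G \<and> diameter G \<le> d \<and> encodes xs G \<longrightarrow>
        (\<exists>t. halts A xs t (biconnected G)))"

text \<open>
  The worst-case number of rounds on graphs of diameter at most \<open>d\<close>, as a function of
  $D' = \mathrm{bidiam}(G)$, is $\Omega(\log D')$ in the sense of not being $o(\log D')$.
\<close>

definition requires_log_bidiam :: "nat \<Rightarrow> mpc \<Rightarrow> bool" where
  "requires_log_bidiam d A \<longleftrightarrow>
     (\<exists>c>0. \<exists>\<^sub>F D' in sequentially.
        \<exists>G xs t b. input_graph G \<and> diameter G \<le> d \<and> bidiam G = D' \<and> encodes xs G \<and>
          halts A xs t b \<and> real t \<ge> c * ln (real D'))"

end

theory Submission imports Defs begin

text \<open>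
  Coning off a cycle instance, that is, joining a new vertex to all vertices, yields a graph of
  diameter at most 2. The cone over one cycle is a wheel and biconnected; in the cone over two
  cycles the apex is a cut vertex. On an \<open>n\<close>-vertex instance the bidiameter of the cone lies
  between \<open>n div 4\<close> and \<open>n + 1\<close>: a simple cycle through two antipodal rim vertices contains an arc
  that avoids the apex and hence runs along half of the rim. So a biconnectivity test that takes
  $o(\log D')$ rounds on cones distinguishes the cycle instances in $o(\log n)$ rounds.
\<close>

section \<open>Vertex sequences\<close>

lemma walk_edges_singleton [simp]: "walk_edges [x] = {}"
  by (simp add: walk_edges_def)

lemma walk_edges_Cons_Cons [simp]:
  "walk_edges (x # y # zs) = insert {x, y} (walk_edges (y # zs))" (is "?l = ?r")
proof
  show "?l \<subseteq> ?r"
  proof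
    fix e assume "e \<in> ?l"
    then obtain i where i: "Suc i < length (x # y # zs)"
      and e: "e = {(x # y # zs) ! i, (x # y # zs) ! Suc i}"
      unfolding walk_edges_def by blast
    show "e \<in> ?r"
      using i e by (cases i) (auto simp: walk_edges_def)
  qed
  show "?r \<subseteq> ?l"
  proof
    fix e assume "e \<in> ?r"
    then consider "e = {x, y}"
      | i where "Suc i < length (y # zs)" "e = {(y # zs) ! i, (y # zs) ! Suc i}"
      unfolding walk_edges_def by blast
    then show "e \<in> ?l"
    proof cases
      case 1
      then show ?thesis unfolding walk_edges_def by (auto intro!: exI[of _ 0])
    next
      case (2 i)
      then show ?thesis unfolding walk_edges_def by (auto intro!: exI[of _ "Suc i"])
    qed
  qed
qed

lemma walk_edges_append:
  "walk_edges (xs @ x # ys) = walk_edges (xs @ [x]) \<union> walk_edges (x # ys)"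
proof (induction xs)
  case (Cons z xs)
  then show ?case by (cases xs) auto
qed simp

lemma walk_edges_snoc:
  "xs \<noteq> [] \<Longrightarrow> walk_edges (xs @ [x]) = insert {last xs, x} (walk_edges xs)"
  by (induction xs rule: induct_list012) auto

lemma walk_edges_conv_image:
  "walk_edges c = (\<lambda>i. {c ! i, c ! Suc i}) ` {..<length c - 1}"
  unfolding walk_edges_def by auto

lemma walk_edges_subset_set: "e \<in> walk_edges c \<Longrightarrow> e \<subseteq> set c"
  unfolding walk_edges_def by auto

lemma walk_iff: "walk G c \<longleftrightarrow> c \<noteq> [] \<and> set c \<subseteq> verts G \<and> walk_edges c \<subseteq> edges G"
  unfolding walk_def walk_edges_def by blast

lemma simple_cycle_nth_last:
  assumes "simple_cycle G c"
  shows "c ! (length c - 1) = c ! 0"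
  using assms unfolding simple_cycle_def walk_def by (metis hd_conv_nth last_conv_nth)

text \<open>The closing vertex is the only repetition: index \<open>0\<close> can be traded for the
  last index, and on positive indices distinctness of \<open>tl c\<close> applies.\<close>

lemma simple_cycle_nth_eqD:
  assumes "simple_cycle G c" "i < length c" "j < length c" "c ! i = c ! j"
  shows "i = j \<or> i = 0 \<and> j = length c - 1 \<or> j = 0 \<and> i = length c - 1"
proof -
  have tl_inj: "k = l" if "0 < k" "0 < l" "k < length c" "l < length c" "c ! k = c ! l" for k l
  proof -
    have "tl c ! (k - 1) = tl c ! (l - 1)" using that by (simp add: nth_tl)
    moreover have "distinct (tl c)" using assms(1) by (simp add: simple_cycle_def)
    ultimately have "k - 1 = l - 1" using that by (simp add: nth_eq_iff_index_eq)
    then show ?thesis using that by simp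
  qed
  have "1 < length c" using assms(1) by (simp add: simple_cycle_def)
  then show ?thesis
    using tl_inj[of i j] tl_inj[of "length c - 1" j] tl_inj[of "length c - 1" i]
      simple_cycle_nth_last[OF assms(1)] assms(2-4)
    by (cases "i = 0"; cases "j = 0") auto
qed

lemma simple_cycle_set_tl:
  assumes "simple_cycle G c"
  shows "set (tl c) = set c"
proof -
  obtain x q where c: "c = x # q" "q \<noteq> []"
    using assms unfolding simple_cycle_def by (cases c) fastforce+
  then have "x = last q" using assms unfolding simple_cycle_def by simp
  then show ?thesis using c by auto
qed

lemma card_set_simple_cycle:
  assumes "simple_cycle G c"
  shows "card (set c) = length c - 1"
  using simple_cycle_set_tl[OF assms] assms distinct_card[of "tl c"]
  by (simp add: simple_cycle_def)

text \<open>Two positions with the same edge could only traverse it in opposite directions, which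
  forces a sequence of three vertices; \<open>4 \<le> length c\<close> excludes this.\<close>

lemma card_walk_edges_simple_cycle:
  assumes "simple_cycle G c"
  shows "card (walk_edges c) = length c - 1"
proof -
  have len: "4 \<le> length c" using assms by (simp add: simple_cycle_def)
  have neq: "{c ! i, c ! Suc i} \<noteq> {c ! j, c ! Suc j}" if "i < j" "j < length c - 1" for i j
  proof
    assume "{c ! i, c ! Suc i} = {c ! j, c ! Suc j}"
    then consider "c ! i = c ! j" | "c ! i = c ! Suc j" "c ! Suc i = c ! j"
      by (auto simp: doubleton_eq_iff)
    then show False
    proof cases
      case 1
      then show False using simple_cycle_nth_eqD[OF assms, of i j] that by linarith
    next
      case 2
      then show False
        using simple_cycle_nth_eqD[OF assms, of i "Suc j"]
          simple_cycle_nth_eqD[OF assms, of "Suc i" j] that len by linarith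
    qed
  qed
  have "inj_on (\<lambda>i. {c ! i, c ! Suc i}) {..<length c - 1}"
  proof (rule inj_onI)
    fix i j assume ij: "i \<in> {..<length c - 1}" "j \<in> {..<length c - 1}"
      and eq: "{c ! i, c ! Suc i} = {c ! j, c ! Suc j}"
    show "i = j"
      using neq[of i j] neq[of j i] ij eq by (metis lessThan_iff linorder_neqE_nat)
  qed
  then show ?thesis unfolding walk_edges_conv_image by (simp add: card_image)
qed

text \<open>Rotating the cycle so that it starts at \<open>x\<close> and dropping the repeated end
  leaves a path through all its vertices, short of just the closing edge. Initial segments of such
  paths are later closed through the apex.\<close>

lemma simple_cycle_cut:
  assumes "simple_cycle G c" "x \<in> set c"
  obtains p where "distinct p" "hd p = x" "set p = set c" "3 \<le> length p" "walk G p"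
    "walk_edges c = insert {last p, hd p} (walk_edges p)"
proof -
  define q where "q = butlast c"
  have len: "4 \<le> length c" and dist: "distinct (tl c)" and eq: "hd c = last c" and w: "walk G c"
    using assms(1) by (auto simp: simple_cycle_def)
  have lenq: "3 \<le> length q" using len by (simp add: q_def)
  have "c \<noteq> []" using len by auto
  then have c: "c = q @ [hd q]"
    using eq lenq unfolding q_def by (metis append_butlast_last_id hd_append2 list.size(3) not_numeral_le_zero)
  have setq: "set q = set c" using c lenq
    by (metis Un_insert_right empty_set hd_in_set insert_absorb list.simps(15) list.size(3)
        not_numeral_le_zero set_append sup_bot.right_neutral)
  have distq: "distinct q"
    using card_set_simple_cycle[OF assms(1)] setq c by (metis card_distinct length_butlast q_def)
  obtain ys zs where q: "q = ys @ x # zs"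
    using assms(2) setq by (metis split_list)
  let ?p = "x # zs @ ys"
  have "walk_edges c = insert {last ?p, hd ?p} (walk_edges ?p)"
  proof (cases ys)
    case Nil
    then show ?thesis using walk_edges_snoc[of q x] c q by simp
  next
    case (Cons y ys')
    have "walk_edges c = walk_edges (ys @ [x]) \<union> walk_edges (x # zs @ [y])"
      using c q Cons walk_edges_append[of ys x "zs @ [y]"] by simp
    moreover have "walk_edges (ys @ [x]) = insert {last ys, x} (walk_edges ys)"
      using Cons by (intro walk_edges_snoc) simp
    moreover have "walk_edges ?p = walk_edges (x # zs @ [y]) \<union> walk_edges ys"
      using Cons walk_edges_append[of "x # zs" y ys'] by simp
    ultimately show ?thesis using Cons by auto
  qed
  moreover have "set ?p = set c" using setq q by auto
  moreover have "distinct ?p" using distq q by auto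
  moreover have "3 \<le> length ?p" using lenq q by simp
  ultimately show thesis using w that[of ?p] by (auto simp: walk_iff)
qed

section \<open>The cone over a graph\<close>

definition cone :: "'a \<Rightarrow> 'a ugraph \<Rightarrow> 'a ugraph" where
  "cone a G = (insert a (verts G), edges G \<union> (\<lambda>v. {v, a}) ` verts G)"

lemma verts_cone [simp]: "verts (cone a G) = insert a (verts G)"
  and edges_cone [simp]: "edges (cone a G) = edges G \<union> (\<lambda>v. {v, a}) ` verts G"
  by (simp_all add: cone_def)

lemma simple_cycle_cone: "simple_cycle G c \<Longrightarrow> simple_cycle (cone a G) c"
  by (auto simp: simple_cycle_def walk_iff)

lemma ugraph_edge_subset: "ugraph G \<Longrightarrow> e \<in> edges G \<Longrightarrow> e \<subseteq> verts G"
  unfolding ugraph_def by fastforce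

lemma ugraph_cone:
  assumes "ugraph G" "a \<notin> verts G"
  shows "ugraph (cone a G)"
  unfolding ugraph_def
proof (intro conjI ballI)
  fix e assume "e \<in> edges (cone a G)"
  then consider "e \<in> edges G" | v where "v \<in> verts G" "e = {v, a}" by auto
  then show "\<exists>u v. e = {u, v} \<and> u \<noteq> v \<and> u \<in> verts (cone a G) \<and> v \<in> verts (cone a G)"
  proof cases
    case 1
    then show ?thesis using assms(1) unfolding ugraph_def by (metis insertCI verts_cone)
  next
    case (2 v)
    then show ?thesis using assms(2) by (intro exI[of _ v] exI[of _ a]) auto
  qed
qed (use assms in \<open>auto simp: ugraph_def\<close>)

section \<open>Distances in a cone, and simple cycles through its apex\<close>

lemma gdist_le: "walk G c \<Longrightarrow> hd c = u \<Longrightarrow> last c = v \<Longrightarrow> gdist G u v \<le> enat (length c - 1)"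
  unfolding gdist_def by (rule INF_lower) simp

lemma gdist_cone_le:
  assumes "u \<in> verts (cone a G)" "v \<in> verts (cone a G)"
  shows "gdist (cone a G) u v \<le> 2"
proof -
  consider "u = a" "v = a" | "u = a" "v \<in> verts G" | "u \<in> verts G" "v = a"
    | "u \<in> verts G" "v \<in> verts G" using assms by auto
  then obtain c where "walk (cone a G) c" "hd c = u" "last c = v" "length c \<le> 3"
  proof cases
    case 1 then show ?thesis by (intro that[of "[a]"]) (auto simp: walk_iff)
  next
    case 2 then show ?thesis
      by (intro that[of "[a, v]"]) (auto simp: walk_iff insert_commute)
  next
    case 3 then show ?thesis by (intro that[of "[u, a]"]) (auto simp: walk_iff)
  next
    case 4 then show ?thesis
      by (intro that[of "[u, a, v]"]) (auto simp: walk_iff insert_commute)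
  qed
  then have "gdist (cone a G) u v \<le> enat (length c - 1)" by (intro gdist_le)
  also have "\<dots> \<le> 2" using \<open>length c \<le> 3\<close> by (simp add: numeral_eq_enat)
  finally show ?thesis .
qed

lemma diameter_cone_le: "diameter (cone a G) \<le> 2"
proof -
  let ?S = "{k. \<exists>u\<in>verts (cone a G). \<exists>v\<in>verts (cone a G). gdist (cone a G) u v = enat k}"
  have le: "k \<le> 2" if k: "k \<in> ?S" for k
  proof -
    obtain u v where "u \<in> verts (cone a G)" "v \<in> verts (cone a G)" "gdist (cone a G) u v = enat k"
      using k by blast
    then show ?thesis using gdist_cone_le[of u a G v] by (simp add: numeral_eq_enat)
  qed
  \<comment> \<open>The apex witnesses that the set under \<open>Max\<close> is nonempty;
    \<open>Max\<close> would otherwise be unspecified.\<close>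
  have "gdist (cone a G) a a \<le> 2" by (intro gdist_cone_le) auto
  then obtain k where "gdist (cone a G) a a = enat k"
    by (metis enat_ile numeral_eq_enat)
  then have "k \<in> ?S" by auto
  then have "?S \<noteq> {}" by blast
  moreover have "finite ?S" using le by (meson finite_nat_set_iff_bounded_le)
  ultimately show ?thesis unfolding diameter_def using le by (intro Max.boundedI)
qed

lemma simple_cycle_through_apex:
  assumes "walk G q" "distinct q" "2 \<le> length q" "a \<notin> verts G"
  shows "simple_cycle (cone a G) (a # q @ [a])"
    and "walk_edges (a # q @ [a]) = insert {hd q, a} (insert {last q, a} (walk_edges q))"
proof -
  obtain x q' where q: "q = x # q'" using assms(3) by (cases q) auto
  show we: "walk_edges (a # q @ [a]) = insert {hd q, a} (insert {last q, a} (walk_edges q))"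
    using walk_edges_snoc[of q a] q by (auto simp: insert_commute)
  have "hd q \<in> verts G" "last q \<in> verts G"
    using assms(1) by (auto simp: walk_iff)
  then show "simple_cycle (cone a G) (a # q @ [a])"
    using assms we unfolding simple_cycle_def walk_iff by auto
qed

text \<open>Two points of a simple cycle bound two arcs, and at least one of them avoids \<open>a\<close>.\<close>

lemma lipschitz_on_simple_cycle:
  fixes f :: "'a \<Rightarrow> int"
  assumes lip: "\<And>x y. {x, y} \<in> edges G \<Longrightarrow> x \<noteq> a \<Longrightarrow> y \<noteq> a \<Longrightarrow> \<bar>f x - f y\<bar> \<le> 1"
    and c: "simple_cycle G c" and uv: "u \<in> set c" "v \<in> set c" "u \<noteq> a" "v \<noteq> a"
  shows "\<bar>f u - f v\<bar> \<le> int (length c - 1)"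
proof -
  have arc: "\<bar>f (c ! i) - f (c ! (i + k))\<bar> \<le> int k"
    if "i + k < length c" "\<And>l. i \<le> l \<Longrightarrow> l \<le> i + k \<Longrightarrow> c ! l \<noteq> a" for i k
    using that
  proof (induction k)
    case (Suc k)
    have "{c ! (i + k), c ! Suc (i + k)} \<in> edges G"
      using c Suc.prems(1) unfolding simple_cycle_def walk_def by auto
    then have "\<bar>f (c ! (i + k)) - f (c ! Suc (i + k))\<bar> \<le> 1"
      using Suc.prems(2) by (intro lip) auto
    moreover have "\<bar>f (c ! i) - f (c ! (i + k))\<bar> \<le> int k"
      using Suc.prems by (intro Suc.IH) auto
    ultimately show ?case by simp
  qed simp
  have ordered: "\<bar>f (c ! i) - f (c ! j)\<bar> \<le> int (length c - 1)"
    if ij: "i \<le> j" "j < length c" "c ! i \<noteq> a" "c ! j \<noteq> a" for i j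
  proof (cases "\<exists>l. i \<le> l \<and> l \<le> j \<and> c ! l = a")
    case False
    then show ?thesis using arc[of i "j - i"] ij by auto
  next
    case True
    then obtain l where l: "i \<le> l" "l \<le> j" "c ! l = a" by auto
    with ij have l': "i < l" "l < j" by (metis le_neq_implies_less)+
    \<comment> \<open>Since \<open>l\<close> lies strictly between \<open>i\<close> and
      \<open>j\<close>, it is the only position of \<open>a\<close>. The complementary arc, from
      \<open>j\<close> to the end and on from \<open>0\<close> to \<open>i\<close>, therefore avoids
      \<open>a\<close>; its two pieces meet because the first and last vertices agree.\<close>
    have avoid: "c ! k \<noteq> a" if "k < length c" "k \<noteq> l" for k
      using simple_cycle_nth_eqD[OF c, of k l] that l l' ij(2) by auto
    have "\<bar>f (c ! 0) - f (c ! i)\<bar> \<le> int i"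
      using arc[of 0 i] avoid l' ij by auto
    moreover have "\<bar>f (c ! j) - f (c ! (length c - 1))\<bar> \<le> int (length c - 1 - j)"
      using arc[of j "length c - 1 - j"] avoid l' ij by auto
    ultimately show ?thesis
      using simple_cycle_nth_last[OF c] ij l' by auto
  qed
  obtain i j where "i < length c" "c ! i = u" "j < length c" "c ! j = v"
    using uv(1,2) by (auto simp: in_set_conv_nth)
  then show ?thesis
    using ordered[of i j] ordered[of j i] uv(3,4) by (cases "i \<le> j") auto
qed

section \<open>Biconnectivity of cones over cycles\<close>

lemma same_bicomponent_sym: "same_bicomponent G e e' \<Longrightarrow> same_bicomponent G e' e"
  unfolding same_bicomponent_def by auto

text \<open>Two rim edges share the rim \<open>c\<close>. What remains is that a spoke shares a
  simple cycle with every edge, and such a cycle arises by closing a rim path that starts at the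
  foot \<open>x\<close> of the spoke through the apex.\<close>

lemma biconnected_cone_cycle:
  assumes c: "simple_cycle G c" "verts G = set c" "edges G = walk_edges c" and a: "a \<notin> verts G"
  shows "biconnected (cone a G)"
proof -
  have rim_rim: "same_bicomponent (cone a G) e e'" if "e \<in> edges G" "e' \<in> edges G" for e e'
    using that c simple_cycle_cone[OF c(1)] unfolding same_bicomponent_def by auto
  have spoke: "same_bicomponent (cone a G) {x, a} e'"
    if x: "x \<in> verts G" and e': "e' \<in> edges (cone a G)" for x e'
  proof -
    obtain p where p: "distinct p" "hd p = x" "set p = set c" "3 \<le> length p" "walk G p"
      "walk_edges c = insert {last p, hd p} (walk_edges p)"
      using simple_cycle_cut[OF c(1)] x c(2) by metis
    obtain p' where p': "p = x # p'" using p by (cases p) auto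
    \<comment> \<open>One witness per case: all of \<open>p\<close> closed through \<open>a\<close>
      covers every rim edge but the closing one; the triangle on \<open>x\<close>,
      \<open>last p\<close> and \<open>a\<close> covers that one; the part of \<open>p\<close> from
      \<open>x\<close> to \<open>y\<close>, closed through \<open>a\<close>, covers the spoke at
      \<open>y \<noteq> x\<close>.\<close>
    from e' consider "e' \<in> walk_edges p" | "e' = {last p, x}"
      | y where "y \<in> set p" "e' = {y, a}"
      using p c by auto
    then show ?thesis
    proof cases
      case 1
      have "2 \<le> length p" using p by simp
      note C = simple_cycle_through_apex[OF p(5,1) this a]
      show ?thesis using C 1 p(2) unfolding same_bicomponent_def by blast
    next
      case 2
      have "walk G [x, last p]"
        using p c p' by (auto simp: walk_iff insert_commute)
      moreover have "distinct [x, last p]" using p p' by (cases p') auto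
      ultimately have "simple_cycle (cone a G) (a # [x, last p] @ [a])"
        using a by (intro simple_cycle_through_apex(1)) auto
      moreover have "{x, a} \<in> walk_edges (a # [x, last p] @ [a])"
        "e' \<in> walk_edges (a # [x, last p] @ [a])" using 2 by (auto simp: insert_commute)
      ultimately show ?thesis unfolding same_bicomponent_def by blast
    next
      case (3 y)
      show ?thesis
      proof (cases "y = x")
        case True
        then show ?thesis using 3 by (simp add: same_bicomponent_def)
      next
        case False
        then obtain us vs where p'': "p = x # us @ y # vs"
          using 3(1) p' by (metis set_ConsD split_list)
        let ?q = "x # us @ [y]"
        have "walk_edges ?q \<subseteq> walk_edges p"
          using walk_edges_append[of "x # us" y vs] p'' by auto
        then have "walk G ?q" using p(5) p'' by (auto simp: walk_iff)
        moreover have "distinct ?q" using p(1) p'' by auto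
        ultimately have "simple_cycle (cone a G) (a # ?q @ [a])"
          "walk_edges (a # ?q @ [a]) = insert {hd ?q, a} (insert {last ?q, a} (walk_edges ?q))"
          using a by (intro simple_cycle_through_apex; simp)+
        moreover from this(2) have "{x, a} \<in> walk_edges (a # ?q @ [a])"
          "e' \<in> walk_edges (a # ?q @ [a])" using 3(2) by simp_all
        ultimately show ?thesis unfolding same_bicomponent_def by blast
      qed
    qed
  qed
  show ?thesis unfolding biconnected_def
  proof (intro ballI)
    fix e e' assume e: "e \<in> edges (cone a G)" "e' \<in> edges (cone a G)"
    then consider "e \<in> edges G" "e' \<in> edges G" | "e \<in> (\<lambda>v. {v, a}) ` verts G"
      | "e' \<in> (\<lambda>v. {v, a}) ` verts G" by auto
    then show "same_bicomponent (cone a G) e e'"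
    proof cases
      case 1
      then show ?thesis by (rule rim_rim)
    next
      case 2
      then show ?thesis using spoke e(2) by (elim imageE) simp
    next
      case 3
      then show ?thesis using spoke e(1) by (elim imageE) (simp add: same_bicomponent_sym)
    qed
  qed
qed

text \<open>The apex is a cut vertex. A potential that is constant along the edges avoiding the
  apex, but differs between the two sides, contradicts \<open>lipschitz_on_simple_cycle\<close> on
  any cycle through \<open>e\<close> and \<open>e'\<close>.\<close>

lemma not_biconnected_cone_disjoint:
  assumes G: "edges G = E \<union> E'" "\<Union>E \<inter> \<Union>E' = {}" "a \<notin> \<Union>(edges G)"
    and e: "e \<in> E" "e \<noteq> {}" and e': "e' \<in> E'" "e' \<noteq> {}"
  shows "\<not> biconnected (cone a G)"
proof
  assume "biconnected (cone a G)"
  then have "same_bicomponent (cone a G) e e'"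
    using G(1) e(1) e'(1) by (simp add: biconnected_def)
  moreover have "e \<noteq> e'" using G(2) e e' by auto
  ultimately obtain c where c: "simple_cycle (cone a G) c" "e \<in> walk_edges c" "e' \<in> walk_edges c"
    unfolding same_bicomponent_def by blast
  obtain u v where uv: "u \<in> e" "v \<in> e'" using e e' by blast
  \<comment> \<open>The jump \<open>length c\<close> is just larger than the bound
    \<open>length c - 1\<close> that a cycle permits.\<close>
  define f where "f x = (if x \<in> \<Union>E then 0 else int (length c))" for x
  have lip: "\<bar>f x - f y\<bar> \<le> 1" if xy: "{x, y} \<in> edges (cone a G)" "x \<noteq> a" "y \<noteq> a" for x y
  proof -
    have "{x, y} \<in> E \<union> E'" using xy G(1) by (auto simp: doubleton_eq_iff)
    then have "x \<in> \<Union>E \<longleftrightarrow> y \<in> \<Union>E" using G(2) by blast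
    then show ?thesis by (simp add: f_def)
  qed
  have "u \<in> set c" "v \<in> set c" using c uv walk_edges_subset_set by blast+
  moreover have "u \<noteq> a" "v \<noteq> a" using G e(1) e'(1) uv by auto
  ultimately have "\<bar>f u - f v\<bar> \<le> int (length c - 1)"
    using lipschitz_on_simple_cycle[where f = f and a = a, OF lip c(1)] by blast
  moreover have "f u = 0" using uv e(1) by (auto simp: f_def)
  moreover have "v \<notin> \<Union>E" using uv e'(1) G(2) by blast
  then have "f v = int (length c)" by (simp add: f_def)
  moreover have "0 < length c" using c(1) by (auto simp: simple_cycle_def)
  ultimately show False by simp
qed

section \<open>The bidiameter of cones\<close>

lemma cyclen_le_card:
  assumes "finite (verts G)" "cyclen G u v = enat k"
  shows "k \<le> card (verts G)"
proof (cases "u = v")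
  case True
  then show ?thesis using assms(2) by (simp add: cyclen_def zero_enat_def)
next
  case False
  let ?C = "{c. simple_cycle G c \<and> u \<in> set c \<and> v \<in> set c}"
  have eq: "(INF c\<in>?C. enat (length c - 1)) = enat k"
    using assms(2) False by (simp add: cyclen_def)
  \<comment> \<open>An infimum over the empty set is infinite in \<open>enat\<close>, so a finite
    value supplies a cycle.\<close>
  have "?C \<noteq> {}"
  proof
    assume "?C = {}"
    show False using eq unfolding \<open>?C = {}\<close> by (simp add: top_enat_def)
  qed
  then obtain c where c: "c \<in> ?C" by blast
  then have "enat k \<le> enat (length c - 1)" unfolding eq[symmetric] by (rule INF_lower)
  moreover have "length c - 1 \<le> card (verts G)"
    using c card_set_simple_cycle[of G c] assms(1)
    by (metis (no_types, lifting) card_mono mem_Collect_eq simple_cycle_def walk_iff)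
  ultimately show ?thesis by simp
qed

text \<open>The \<open>Max\<close> in \<open>bidiam\<close> ranges over a finite set by
  \<open>cyclen_le_card\<close>, and \<open>cyclen G w w = 0\<close> makes the set nonempty.\<close>

lemma bidiam_le_card:
  assumes "finite (verts G)" "verts G \<noteq> {}"
  shows "bidiam G \<le> card (verts G)"
    and "\<lbrakk>u \<in> verts G; v \<in> verts G; cyclen G u v = enat k\<rbrakk> \<Longrightarrow> k \<le> bidiam G"
proof -
  let ?S = "{k. \<exists>u\<in>verts G. \<exists>v\<in>verts G. cyclen G u v = enat k}"
  have le: "k \<le> card (verts G)" if "k \<in> ?S" for k
    using that cyclen_le_card[OF assms(1)] by blast
  then have fin: "finite ?S" by (meson finite_nat_set_iff_bounded_le)
  obtain w where "w \<in> verts G" using assms(2) by blast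
  then have "0 \<in> ?S" by (auto simp: cyclen_def zero_enat_def)
  then show "bidiam G \<le> card (verts G)"
    unfolding bidiam_def using fin le by (intro Max.boundedI) auto
  show "\<lbrakk>u \<in> verts G; v \<in> verts G; cyclen G u v = enat k\<rbrakk> \<Longrightarrow> k \<le> bidiam G"
    unfolding bidiam_def using fin by (intro Max_ge) auto
qed

text \<open>The witnesses are the first vertex of \<open>c\<close> and the one halfway along it.
  Distance along \<open>c\<close> from the first vertex serves as the potential in
  \<open>lipschitz_on_simple_cycle\<close>; \<open>comp\<close> excludes chords and edges leaving
  \<open>c\<close>, so the potential changes by at most 1 along edges that avoid the apex.\<close>

lemma bidiam_cone_ge:
  assumes G: "ugraph G" "a \<notin> verts G" and c: "simple_cycle G c"
    and comp: "\<And>e. e \<in> edges G \<Longrightarrow> e \<in> walk_edges c \<or> e \<inter> set c = {}"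
  shows "(length c - 1) div 2 \<le> bidiam (cone a G)"
proof -
  define m where "m = length c - 1"
  have m: "3 \<le> m" "length c = Suc m" using c by (auto simp: m_def simple_cycle_def)
  \<comment> \<open>This is the distance from position \<open>0\<close> on a cycle of length
    \<open>m\<close>. It takes the same value at \<open>0\<close> and \<open>m\<close>, so the index
    picked by \<open>SOME\<close> below does not matter.\<close>
  define h where "h i = min (int i) (int m - int i)" for i
  define f where "f x = (if x \<in> set c then h (SOME i. i \<le> m \<and> c ! i = x) else 0)" for x
  have f_nth: "f (c ! i) = h i" if "i \<le> m" for i
  proof -
    define j where "j = (SOME j. j \<le> m \<and> c ! j = c ! i)"
    have "j \<le> m \<and> c ! j = c ! i" unfolding j_def by (rule someI[of _ i]) (use that in auto)
    then have "j = i \<or> j = 0 \<and> i = m \<or> i = 0 \<and> j = m"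
      using simple_cycle_nth_eqD[OF c, of j i] that by (auto simp: m(2))
    then have "h j = h i" by (auto simp: h_def)
    then show ?thesis using that m by (simp add: f_def j_def)
  qed
  have lip: "\<bar>f x - f y\<bar> \<le> 1" if xy: "{x, y} \<in> edges (cone a G)" "x \<noteq> a" "y \<noteq> a" for x y
  proof -
    have "{x, y} \<in> edges G" using xy by (auto simp: doubleton_eq_iff)
    from comp[OF this] show ?thesis
    proof
      assume "{x, y} \<in> walk_edges c"
      then obtain i where i: "i < m" "{x, y} = {c ! i, c ! Suc i}"
        unfolding walk_edges_conv_image m_def by auto
      have "\<bar>f (c ! i) - f (c ! Suc i)\<bar> \<le> 1" using i(1) by (simp add: f_nth) (simp add: h_def)
      then show ?thesis using i(2) by (auto simp: doubleton_eq_iff abs_minus_commute)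
    qed (simp add: f_def)
  qed
  have sub: "set c \<subseteq> verts G" using c by (simp add: simple_cycle_def walk_iff)
  let ?u = "c ! 0" and ?v = "c ! (m div 2)"
  have uv: "?u \<in> set c" "?v \<in> set c" using m by auto
  have fuv: "f ?u = 0" "f ?v = int (m div 2)" by (simp_all add: f_nth) (simp_all add: h_def)
  moreover have "int (m div 2) \<noteq> 0" using m(1) by simp
  ultimately have "?u \<noteq> ?v" by metis
  have ge: "m div 2 \<le> length d - 1"
    if "simple_cycle (cone a G) d" "?u \<in> set d" "?v \<in> set d" for d
    using lipschitz_on_simple_cycle[where f = f and a = a, OF lip that(1), of ?u ?v] that(2,3) uv sub G(2) fuv by force
  have cyc: "cyclen (cone a G) ?u ?v =
      (INF d \<in> {d. simple_cycle (cone a G) d \<and> ?u \<in> set d \<and> ?v \<in> set d}. enat (length d - 1))"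
    using \<open>?u \<noteq> ?v\<close> by (simp add: cyclen_def)
  \<comment> \<open>The cycle \<open>c\<close> itself makes this value finite, so that it enters the
    maximum defining \<open>bidiam\<close>.\<close>
  have "cyclen (cone a G) ?u ?v \<le> enat (length c - 1)"
    unfolding cyc using simple_cycle_cone[OF c] uv by (intro INF_lower) auto
  then obtain k where k: "cyclen (cone a G) ?u ?v = enat k" using enat_ile by blast
  have "enat (m div 2) \<le> cyclen (cone a G) ?u ?v"
    unfolding cyc using ge by (intro INF_greatest) auto
  then have "m div 2 \<le> k" using k by simp
  also have "k \<le> bidiam (cone a G)"
    using k uv sub G(1) by (intro bidiam_le_card(2)[of _ ?u ?v]) (auto simp: ugraph_def)
  finally show ?thesis by (simp add: m_def)
qed

section \<open>Encodings of cycle instances\<close>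

lemma ugraph_finite_edges: "ugraph G \<Longrightarrow> finite (edges G)"
  using ugraph_edge_subset[of G] unfolding ugraph_def
  by (metis PowI finite_Pow_iff finite_subset subsetI)

lemma length_concat_pairs: "length (concat (map (\<lambda>(u, v). [u, v]) ps)) = 2 * length ps"
  by (induction ps) auto

text \<open>Vertex records yield singletons and edge records two-element sets, so the two counts add
  up. On cycle instances the length is thus \<open>4 * n\<close>, from which \<open>n\<close> can be
  recovered.\<close>

lemma encodes_length:
  assumes "ugraph G" "encodes xs G"
  shows "length xs = 2 * (card (verts G) + card (edges G))"
proof -
  obtain ps where ps: "xs = concat (map (\<lambda>(u, v). [u, v]) ps)"
    "distinct (map (\<lambda>(u, v). {u, v}) ps)"
    "set (map (\<lambda>(u, v). {u, v}) ps) = (\<lambda>v. {v}) ` verts G \<union> edges G"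
    using assms(2) unfolding encodes_def by blast
  have "length ps = card ((\<lambda>v. {v}) ` verts G \<union> edges G)"
    using distinct_card[OF ps(2)] ps(3) by simp
  also have "\<dots> = card ((\<lambda>v. {v}) ` verts G) + card (edges G)"
  proof (rule card_Un_disjoint)
    show "(\<lambda>v. {v}) ` verts G \<inter> edges G = {}"
      using assms(1) unfolding ugraph_def by (fastforce simp: doubleton_eq_iff)
    show "finite (edges G)" by (rule ugraph_finite_edges[OF assms(1)])
    show "finite ((\<lambda>v. {v}) ` verts G)" using assms(1) by (simp add: ugraph_def)
  qed
  also have "card ((\<lambda>v. {v}) ` verts G) = card (verts G)"
    by (rule card_image) (simp add: inj_on_def)
  finally show ?thesis using ps(1) by (simp add: length_concat_pairs)
qed

text \<open>Together with \<open>encodes_length\<close> this leaves finitely many inputs per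
  \<open>n\<close>, so that a worst-case round count exists.\<close>

lemma encodes_subset:
  assumes "ugraph G" "encodes xs G"
  shows "set xs \<subseteq> verts G"
proof
  fix w assume "w \<in> set xs"
  obtain ps where ps: "xs = concat (map (\<lambda>(u, v). [u, v]) ps)"
    "set (map (\<lambda>(u, v). {u, v}) ps) = (\<lambda>v. {v}) ` verts G \<union> edges G"
    using assms(2) unfolding encodes_def by blast
  obtain u v where "(u, v) \<in> set ps" "w \<in> {u, v}"
    using \<open>w \<in> set xs\<close> ps(1) by auto
  moreover from this(1) have "{u, v} \<in> (\<lambda>v. {v}) ` verts G \<union> edges G"
    unfolding ps(2)[symmetric] by force
  ultimately show "w \<in> verts G" using ugraph_edge_subset[OF assms(1)] by blast
qed

text \<open>The records that an encoding of the cone needs beyond those of a graph on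
  \<open>{..<n}\<close>. The apex gets the next free label \<open>n\<close>, which keeps the vertex
  set an initial segment.\<close>

definition apex_records :: "nat \<Rightarrow> nat list" where
  "apex_records n = concat (map (\<lambda>(u, v). [u, v]) ((n, n) # map (\<lambda>v. (v, n)) [0..<n]))"

lemma length_apex_records: "length (apex_records n) = 2 * n + 2"
  unfolding apex_records_def length_concat_pairs by simp

text \<open>Every added record contains \<open>n\<close> and no old one does, so the combined
  records stay distinct.\<close>

lemma encodes_cone:
  assumes "ugraph G" "verts G = {..<n}" "encodes xs G"
  shows "encodes (xs @ apex_records n) (cone n G)"
proof -
  obtain ps where ps: "xs = concat (map (\<lambda>(u, v). [u, v]) ps)"
    "distinct (map (\<lambda>(u, v). {u, v}) ps)"
    "set (map (\<lambda>(u, v). {u, v}) ps) = (\<lambda>v. {v}) ` verts G \<union> edges G"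
    using assms(3) unfolding encodes_def by blast
  let ?qs = "(n, n) # map (\<lambda>v. (v, n)) [0..<n]"
  have qs: "map (\<lambda>(u, v). {u, v}) ?qs = {n} # map (\<lambda>v. {v, n}) [0..<n]" by simp
  have "inj_on (\<lambda>v. {v, n}) (set [0..<n])"
    by (rule inj_onI) (simp add: doubleton_eq_iff)
  then have "distinct (map (\<lambda>v. {v, n}) [0..<n])" unfolding distinct_map by simp
  moreover have "{n} \<notin> set (map (\<lambda>v. {v, n}) [0..<n])"
  proof
    assume "{n} \<in> set (map (\<lambda>v. {v, n}) [0..<n])"
    then obtain v where "v < n" "{n} = {v, n}" unfolding set_map by (elim imageE) simp
    moreover from this(2) have "v = n" by blast
    ultimately show False by simp
  qed
  ultimately have "distinct (map (\<lambda>(u, v). {u, v}) ?qs)"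
    unfolding qs distinct.simps by (intro conjI)
  moreover have "n \<notin> e" if "e \<in> set (map (\<lambda>(u, v). {u, v}) ps)" for e
    using that ugraph_edge_subset[OF assms(1), of e] assms(2) unfolding ps(3) by auto
  then have "set (map (\<lambda>(u, v). {u, v}) ps) \<inter> set (map (\<lambda>(u, v). {u, v}) ?qs) = {}"
    unfolding qs by fastforce
  ultimately have "distinct (map (\<lambda>(u, v). {u, v}) (ps @ ?qs))"
    using ps(2) by (simp only: map_append distinct_append)
  moreover have "set (map (\<lambda>(u, v). {u, v}) (ps @ ?qs)) =
      (\<lambda>v. {v}) ` verts (cone n G) \<union> edges (cone n G)"
    unfolding map_append set_append ps(3) qs using assms(2) by auto
  moreover have "xs @ apex_records n = concat (map (\<lambda>(u, v). [u, v]) (ps @ ?qs))"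
    unfolding apex_records_def ps(1) by simp
  ultimately show ?thesis unfolding encodes_def by blast
qed

text \<open>The bound \<open>n div 4\<close> comes from the two-cycle case: each cycle has half of
  the vertices, and \<open>bidiam_cone_ge\<close> halves once more.\<close>

lemma cycle_instance_cone:
  assumes G: "input_graph G" and cyc: "one_cycle n G \<or> two_cycles n G"
  shows "verts G = {..<n}" and "card (edges G) = n"
    and "biconnected (cone n G) \<longleftrightarrow> one_cycle n G" and "n div 4 \<le> bidiam (cone n G)"
proof -
  have ug: "ugraph G" using G by (simp add: input_graph_def)
  obtain k where k: "verts G = {..<k}" using G unfolding input_graph_def by blast
  have one: "biconnected (cone n G) \<and> card (edges G) = n \<and> verts G = {..<n} \<and>
      n div 4 \<le> bidiam (cone n G)" if oc: "one_cycle n G"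
  proof -
    obtain c where c: "card (verts G) = n" "simple_cycle G c" "verts G = set c"
      "edges G = walk_edges c"
      using oc unfolding one_cycle_def by blast
    have v: "verts G = {..<n}" using c(1) k by simp
    then have "n \<notin> verts G" by simp
    moreover have "length c - 1 = n" using card_set_simple_cycle[OF c(2)] c by simp
    ultimately show ?thesis
      using biconnected_cone_cycle[OF c(2-4)] card_walk_edges_simple_cycle[OF c(2)] v c(4)
        bidiam_cone_ge[OF ug _ c(2), of n]
      by fastforce
  qed
  have two: "\<not> biconnected (cone n G) \<and> card (edges G) = n \<and> verts G = {..<n} \<and>
      n div 4 \<le> bidiam (cone n G)" if tc: "two_cycles n G"
  proof -
    obtain c c' where c: "simple_cycle G c" "simple_cycle G c'" "set c \<inter> set c' = {}"
      "2 * card (set c) = n" "2 * card (set c') = n" "verts G = set c \<union> set c'"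
      "edges G = walk_edges c \<union> walk_edges c'"
      using tc unfolding two_cycles_def by blast
    have "card (verts G) = n" using c(3-6) by (simp add: card_Un_disjoint)
    then have v: "verts G = {..<n}" using k by simp
    then have n: "n \<notin> verts G" by simp
    have len: "2 * (length c - 1) = n" "2 * (length c' - 1) = n"
      using card_set_simple_cycle c(1,2,4,5) by metis+
    have disj: "\<Union>(walk_edges c) \<inter> \<Union>(walk_edges c') = {}"
      using c(3) walk_edges_subset_set[of _ c] walk_edges_subset_set[of _ c'] by blast
    have first: "{d ! 0, d ! Suc 0} \<in> walk_edges d" if "simple_cycle G d" for d
      using that unfolding walk_edges_def simple_cycle_def by fastforce
    have "walk_edges c \<inter> walk_edges c' = {}"
    proof (rule ccontr)
      assume "walk_edges c \<inter> walk_edges c' \<noteq> {}"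
      then obtain e where e: "e \<in> walk_edges c" "e \<in> walk_edges c'" by blast
      moreover have "e \<noteq> {}" using e(1) unfolding walk_edges_def by blast
      ultimately show False using disj by blast
    qed
    moreover have "finite (walk_edges c)" "finite (walk_edges c')"
      by (simp_all add: walk_edges_conv_image)
    ultimately have "card (edges G) = n"
      using c(7) card_walk_edges_simple_cycle[OF c(1)] card_walk_edges_simple_cycle[OF c(2)] len
      by (simp add: card_Un_disjoint)
    moreover have "\<not> biconnected (cone n G)"
    proof (rule not_biconnected_cone_disjoint[OF c(7) disj _ first[OF c(1)] _ first[OF c(2)]])
      show "n \<notin> \<Union>(edges G)" using ugraph_edge_subset[OF ug] n by blast
    qed auto
    moreover have "(length c - 1) div 2 \<le> bidiam (cone n G)"
    proof (rule bidiam_cone_ge[OF ug n c(1)])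
      fix e assume "e \<in> edges G"
      then show "e \<in> walk_edges c \<or> e \<inter> set c = {}"
        using c(3,7) walk_edges_subset_set[of e c'] by blast
    qed
    moreover have "n div 4 \<le> (length c - 1) div 2" using len(1) by linarith
    ultimately show ?thesis using v by linarith
  qed
  show "verts G = {..<n}" "card (edges G) = n"
    "biconnected (cone n G) \<longleftrightarrow> one_cycle n G" "n div 4 \<le> bidiam (cone n G)"
    using cyc one two by blast+
qed

section \<open>Simulation on the cone\<close>

text \<open>For the encoding of \<open>n\<close> vertices and \<open>n\<close> edges, \<open>N = 4 n\<close>, and the encoding of the
  cone has $2 ((n + 1) + 2 n) = 6 n + 2$ words.\<close>

definition cone_size :: "nat \<Rightarrow> nat" where
  "cone_size N = N + N div 2 + 2"

text \<open>The apex records depend on \<open>n\<close> alone, so every machine can append its share of them to its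
  part of the input without communication.\<close>

definition apex_chunk :: "mpc \<Rightarrow> nat \<Rightarrow> nat \<Rightarrow> nat list" where
  "apex_chunk A N i = (let l = load A (cone_size N) in
     take (l - (N - i * l)) (drop (i * l - N) (apex_records (N div 4))))"

text \<open>Runs \<open>A\<close> with its parameters for the size of the cone. The padding is
  applied where round 0 first reads the memory; \<open>answer\<close> pads too because
  \<open>A\<close> may halt after zero rounds.\<close>

definition on_cone :: "mpc \<Rightarrow> mpc" where
  "on_cone A =
    \<lparr>memory = \<lambda>N. memory A (cone_size N),
     machines = \<lambda>N. machines A (cone_size N),
     word_bits = \<lambda>N. word_bits A (cone_size N),
     load = \<lambda>N. load A (cone_size N),
     compute = \<lambda>N r i m.
       compute A (cone_size N) r i (if r = 0 then m @ apex_chunk A N i else m),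
     answer = \<lambda>N r m.
       answer A (cone_size N) r (if r = 0 then m @ apex_chunk A N 0 else m)\<rparr>"

lemma on_cone_simps [simp]:
  "memory (on_cone A) N = memory A (cone_size N)"
  "machines (on_cone A) N = machines A (cone_size N)"
  "word_bits (on_cone A) N = word_bits A (cone_size N)"
  "load (on_cone A) N = load A (cone_size N)"
  "compute (on_cone A) N r i m =
     compute A (cone_size N) r i (if r = 0 then m @ apex_chunk A N i else m)"
  "answer (on_cone A) N r m =
     answer A (cone_size N) r (if r = 0 then m @ apex_chunk A N 0 else m)"
  by (simp_all add: on_cone_def)

lemma halts_on_cone:
  assumes len: "length xs = 4 * n" and halts: "halts A (xs @ apex_records n) t b"
  shows "halts (on_cone A) xs t b"
proof -
  let ?B = "on_cone A" and ?ys = "xs @ apex_records n"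
  have len': "length ?ys = cone_size (length xs)"
    using len by (simp add: length_apex_records cone_size_def)
  have div: "length xs div 4 = n" using len by simp
  \<comment> \<open>This splits \<open>take\<close> and \<open>drop\<close> over the append.
    Truncated subtraction gives an empty chunk on machines filled by \<open>xs\<close> and a full
    quota of \<open>l\<close> words past the end of \<open>xs\<close>.\<close>
  have conf0: "config ?B xs 0 i @ apex_chunk A (length xs) i = config A ?ys 0 i" for i
    unfolding config.simps len' on_cone_simps apex_chunk_def div Let_def
    by (simp add: add.commute)
  \<comment> \<open>The two runs differ only before the first computation, and there by exactly the
    padding, so messages and all later configurations coincide.\<close>
  have padded: "(if r = 0 then config ?B xs r i @ apex_chunk A (length xs) i else config ?B xs r i)
      = config A ?ys r i" for r i
  proof (induction r arbitrary: i)
    case 0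
    show ?case using conf0 by simp
  next
    case (Suc r)
    have "config ?B xs (Suc r) i = config A ?ys (Suc r) i"
      unfolding config.simps len' on_cone_simps Suc.IH ..
    then show ?case by simp
  qed
  have ans: "answer ?B (length xs) r (config ?B xs r 0) = answer A (length ?ys) r (config A ?ys r 0)"
    for r unfolding on_cone_simps padded len' ..
  have msg: "msg ?B xs r i j = msg A ?ys r i j" for r i j
    unfolding msg_def on_cone_simps padded len' ..
  have comm: "communication_ok ?B xs r \<longleftrightarrow> communication_ok A ?ys r" for r
    unfolding communication_ok_def msg on_cone_simps len' ..
  \<comment> \<open>At \<open>r = 0\<close> the memory of \<open>?B\<close> is only a prefix of that
    of \<open>A\<close>; this suffices because the memory bounds pass to prefixes.\<close>
  have prefix: "\<exists>zs. config A ?ys r i = config ?B xs r i @ zs" for r i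
    using padded[of r i] by (cases "r = 0") (metis append_Nil2)+
  have mem: "memory_ok ?B xs r" if ok: "memory_ok A ?ys r" for r
    unfolding memory_ok_def on_cone_simps
  proof (intro allI impI)
    fix i assume i: "i < machines A (cone_size (length xs))"
    obtain zs where "config A ?ys r i = config ?B xs r i @ zs" using prefix by blast
    then show "length (config ?B xs r i) \<le> memory A (cone_size (length xs)) \<and>
        (\<forall>w\<in>set (config ?B xs r i). w < 2 ^ word_bits A (cone_size (length xs)))"
      using ok i unfolding memory_ok_def len' by fastforce
  qed
  show ?thesis using halts mem unfolding halts_def ans comm by blast
qed

section \<open>Growth of \<open>cone_size\<close> and the resource bounds of
  \<open>on_cone\<close>\<close>

lemma filterlim_cone_size: "filterlim cone_size at_top at_top"
  by (rule filterlim_at_top_mono[OF filterlim_ident]) (simp add: cone_size_def)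

lemma cone_size_bounds: "N \<le> cone_size N" "0 < N \<Longrightarrow> cone_size N \<le> 4 * N"
  by (auto simp: cone_size_def)

lemma bigtheta_sandwich:
  fixes f g :: "'a \<Rightarrow> real"
  assumes "0 < c" "eventually (\<lambda>x. 0 \<le> f x \<and> f x \<le> g x \<and> g x \<le> c * f x) F"
  shows "g \<in> \<Theta>[F](f)"
  by (rule bigthetaI'[of 1 c]) (use assms in \<open>auto elim!: eventually_mono\<close>)

lemma cone_size_bigtheta: "(\<lambda>N. real (cone_size N)) \<in> \<Theta>(\<lambda>N. real N)"
proof (rule bigtheta_sandwich[of 4])
  show "\<forall>\<^sub>F N in sequentially. 0 \<le> real N \<and> real N \<le> real (cone_size N) \<and>
      real (cone_size N) \<le> 4 * real N"
    using eventually_gt_at_top[of 0]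
  proof eventually_elim
    case (elim N)
    then have "real (cone_size N) \<le> real (4 * N)" by (simp only: of_nat_le_iff cone_size_bounds)
    then show ?case using cone_size_bounds(1)[of N] by simp
  qed
qed simp

lemma cone_size_powr_bigtheta:
  "(\<lambda>N. real (cone_size N) powr p) \<in> \<Theta>(\<lambda>N. real N powr p)"
  using bigtheta_powr[OF cone_size_bigtheta, of p] by simp

text \<open>The factor 4 is an integer, so a bound by four times a quotient survives rounding both
  quotients up.\<close>

lemma ceiling_cone_size_bigtheta:
  assumes "\<And>N. 0 < N \<Longrightarrow> 0 < l N"
  shows "(\<lambda>N. real_of_int \<lceil>real (cone_size N) / real (l N)\<rceil>) \<in>
    \<Theta>(\<lambda>N. real_of_int \<lceil>real N / real (l N)\<rceil>)"
proof (rule bigtheta_sandwich[of 4])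
  show "\<forall>\<^sub>F N in sequentially. 0 \<le> real_of_int \<lceil>real N / real (l N)\<rceil> \<and>
      real_of_int \<lceil>real N / real (l N)\<rceil> \<le> real_of_int \<lceil>real (cone_size N) / real (l N)\<rceil> \<and>
      real_of_int \<lceil>real (cone_size N) / real (l N)\<rceil> \<le> 4 * real_of_int \<lceil>real N / real (l N)\<rceil>"
    using eventually_gt_at_top[of 0]
  proof eventually_elim
    case (elim N)
    have l: "0 < real (l N)" using assms elim by simp
    have "real (cone_size N) \<le> real (4 * N)" using elim by (simp only: of_nat_le_iff cone_size_bounds)
    then have "real (cone_size N) / real (l N) \<le> 4 * (real N / real (l N))"
      using l by (simp add: divide_right_mono)
    also have "\<dots> \<le> of_int (4 * \<lceil>real N / real (l N)\<rceil>)"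
      using le_of_int_ceiling[of "real N / real (l N)"] by linarith
    finally have "\<lceil>real (cone_size N) / real (l N)\<rceil> \<le> 4 * \<lceil>real N / real (l N)\<rceil>"
      by (simp only: ceiling_le_iff)
    then have "real_of_int \<lceil>real (cone_size N) / real (l N)\<rceil> \<le>
        real_of_int (4 * \<lceil>real N / real (l N)\<rceil>)" by (simp only: of_int_le_iff)
    moreover have "real N / real (l N) \<le> real (cone_size N) / real (l N)"
      using l cone_size_bounds(1)[of N] by (simp add: divide_right_mono)
    then have "\<lceil>real N / real (l N)\<rceil> \<le> \<lceil>real (cone_size N) / real (l N)\<rceil>"
      by (rule ceiling_mono)
    moreover have "0 \<le> \<lceil>real N / real (l N)\<rceil>"
      using ceiling_mono[of 0 "real N / real (l N)"] by simp
    ultimately show ?case by simp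
  qed
qed simp

text \<open>Composition with \<open>cone_size\<close> preserves the asymptotic conditions on
  \<open>A\<close>, and \<open>cone_size N\<close> is of order \<open>N\<close>, so they can be
  restated in \<open>N\<close>.\<close>

lemma mpc_algorithm_on_cone:
  assumes "mpc_algorithm \<gamma> \<delta> A"
  shows "mpc_algorithm \<gamma> \<delta> (on_cone A)"
proof -
  note A = assms[unfolded mpc_algorithm_def]
  have compose: "(\<lambda>N. f (cone_size N)) \<in> \<Theta>(\<lambda>N. g (cone_size N))"
    if "f \<in> \<Theta>(g)" for f g :: "nat \<Rightarrow> real"
    using that filterlim_cone_size by (rule landau_theta.compose)
  have A_last: "0 < load A N \<and> load A N \<le> memory A N \<and>
        N \<le> machines A N * load A N \<and> N \<le> 2 ^ word_bits A N" if "0 < N" for N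
    using A that by blast
  have pos: "0 < cone_size N" for N by (simp add: cone_size_def)
  have "(\<lambda>N. real (memory A (cone_size N))) \<in> \<Theta>(\<lambda>N. real (cone_size N) powr \<delta>)"
    using A by (intro compose[of "\<lambda>N. real (memory A N)"]) blast
  also note cone_size_powr_bigtheta
  finally have mem: "(\<lambda>N. real (memory A (cone_size N))) \<in> \<Theta>(\<lambda>N. real N powr \<delta>)" .
  have "(\<lambda>N. real (machines A (cone_size N) * memory A (cone_size N)))
      \<in> \<Theta>(\<lambda>N. real (cone_size N) powr (1 + \<gamma>))"
    using A by (intro compose[of "\<lambda>N. real (machines A N * memory A N)"]) blast
  also note cone_size_powr_bigtheta
  finally have mach: "(\<lambda>N. real (machines A (cone_size N) * memory A (cone_size N)))
      \<in> \<Theta>(\<lambda>N. real N powr (1 + \<gamma>))" .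
  have bits: "(\<lambda>N. real (word_bits A (cone_size N))) \<in>
      \<Theta>(\<lambda>N. ln (real (memory A (cone_size N) * machines A (cone_size N))))"
    using A by (intro compose[of "\<lambda>N. real (word_bits A N)"]) blast
  \<comment> \<open>Here \<open>N\<close> meets parameters taken at \<open>cone_size N\<close>: the
    numerator is enlarged to \<open>cone_size N\<close>, the condition on \<open>A\<close> is
    applied, and the numerator is brought back.\<close>
  have "(\<lambda>N. real_of_int \<lceil>real N / real (load A (cone_size N))\<rceil>) \<in>
      \<Theta>(\<lambda>N. real_of_int \<lceil>real (cone_size N) / real (load A (cone_size N))\<rceil>)"
    using A_last pos by (subst bigtheta_sym, intro ceiling_cone_size_bigtheta) blast
  also have "(\<lambda>N. real_of_int \<lceil>real (cone_size N) / real (load A (cone_size N))\<rceil>) \<in>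
      \<Theta>(\<lambda>N. real (cone_size N) / real (memory A (cone_size N)))"
    using A by (intro compose[of "\<lambda>N. real_of_int \<lceil>real N / real (load A N)\<rceil>"]) blast
  also have "(\<lambda>N. real (cone_size N) / real (memory A (cone_size N))) \<in>
      \<Theta>(\<lambda>N. real N / real (memory A (cone_size N)))"
  proof (intro landau_theta.divide_right cone_size_bigtheta always_eventually allI)
    fix N
    show "real (memory A (cone_size N)) \<noteq> 0" using A_last[OF pos[of N]] by simp
  qed
  finally have load: "(\<lambda>N. real_of_int \<lceil>real N / real (load A (cone_size N))\<rceil>) \<in>
      \<Theta>(\<lambda>N. real N / real (memory A (cone_size N)))" .
  have "0 < load A (cone_size N) \<and> load A (cone_size N) \<le> memory A (cone_size N) \<and>
        N \<le> machines A (cone_size N) * load A (cone_size N) \<and> N \<le> 2 ^ word_bits A (cone_size N)" for N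
    using A_last[OF pos[of N]] cone_size_bounds(1)[of N] by auto
  with mem mach bits load show ?thesis unfolding mpc_algorithm_def on_cone_simps by blast
qed

section \<open>Running times\<close>

lemma halts_unique:
  assumes "halts A xs t b" "halts A xs t' b'"
  shows "t = t'"
  using assms unfolding halts_def by (metis linorder_neqE_nat option.distinct(1))

text \<open>The maximum of this set is the running time claimed for \<open>on_cone A\<close>. The
  set is empty for \<open>n < 3\<close>, hence the \<open>insert 0\<close> wherever the maximum is
  taken.\<close>

definition cone_times :: "mpc \<Rightarrow> nat \<Rightarrow> nat set" where
  "cone_times A n = {t. \<exists>G xs b. input_graph G \<and> (one_cycle n G \<or> two_cycles n G) \<and>
     encodes xs G \<and> halts A (xs @ apex_records n) t b}"

lemma finite_cone_times: "finite (cone_times A n)"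
proof -
  let ?X = "{xs. set xs \<subseteq> {..<n} \<and> length xs = 4 * n}"
  have "cone_times A n \<subseteq> (\<lambda>xs. THE t. \<exists>b. halts A (xs @ apex_records n) t b) ` ?X"
  proof
    fix t assume "t \<in> cone_times A n"
    then obtain G xs b where G: "input_graph G" "one_cycle n G \<or> two_cycles n G"
      "encodes xs G" "halts A (xs @ apex_records n) t b"
      unfolding cone_times_def by blast
    have ug: "ugraph G" using G(1) by (simp add: input_graph_def)
    have "xs \<in> ?X"
      using encodes_subset[OF ug G(3)] encodes_length[OF ug G(3)]
        cycle_instance_cone(1,2)[OF G(1,2)] by simp
    moreover have "(THE t. \<exists>b. halts A (xs @ apex_records n) t b) = t"
      using G(4) halts_unique by (intro the_equality) blast+
    ultimately show "t \<in> (\<lambda>xs. THE t. \<exists>b. halts A (xs @ apex_records n) t b) ` ?X" by force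
  qed
  moreover have "finite ?X" by (rule finite_lists_length_eq) simp
  ultimately show ?thesis by (meson finite_surj)
qed

lemma input_graph_cone:
  assumes "input_graph G" "verts G = {..<n}"
  shows "input_graph (cone n G)"
proof -
  have "ugraph (cone n G)" using assms by (intro ugraph_cone) (auto simp: input_graph_def)
  moreover have "verts (cone n G) = {..<Suc n}" using assms(2) by (simp add: lessThan_Suc)
  ultimately show ?thesis unfolding input_graph_def by blast
qed

text \<open>The bidiameter of the cone is at least \<open>n div 4\<close>, so a bound valid for
  large \<open>D'\<close> holds for large \<open>n\<close>; it is at most \<open>n + 1\<close>, so a
  bound in \<open>ln D'\<close> becomes one in \<open>ln n\<close>.\<close>

lemma cone_times_smallo:
  assumes "2 \<le> d" and "\<not> requires_log_bidiam d A"
  shows "(\<lambda>n. real (Max (insert 0 (cone_times A n)))) \<in> o(\<lambda>n. ln (real n))"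
proof (rule landau_o.smallI)
  fix c :: real assume c: "0 < c"
  \<comment> \<open>The halving pays for the estimate \<open>bidiam \<le> n ^ 2\<close>, whose
    logarithm is twice \<open>ln n\<close>.\<close>
  then have "0 < c / 2" by simp
  then have "\<forall>\<^sub>F D in sequentially. \<not> (\<exists>G xs t b. input_graph G \<and> diameter G \<le> d \<and>
      bidiam G = D \<and> encodes xs G \<and> halts A xs t b \<and> real t \<ge> c / 2 * ln (real D))"
    using assms(2) unfolding requires_log_bidiam_def frequently_def by blast
  then obtain D0 where D0: "\<And>G xs t b. \<lbrakk>D0 \<le> bidiam G; input_graph G; diameter G \<le> d;
      encodes xs G; halts A xs t b\<rbrakk> \<Longrightarrow> real t < c / 2 * ln (real (bidiam G))"
    unfolding eventually_sequentially by (metis not_le)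
  show "\<forall>\<^sub>F n in sequentially. norm (real (Max (insert 0 (cone_times A n)))) \<le> c * norm (ln (real n))"
    \<comment> \<open>This makes \<open>n div 4\<close> at least \<open>D0 + 1\<close>: the
      bidiameter is past the threshold \<open>D0\<close> and positive, as monotonicity of
      \<open>ln\<close> requires.\<close>
    using eventually_ge_at_top[of "4 * D0 + 4"]
  proof eventually_elim
    case (elim n)
    have bound: "real t \<le> c * ln (real n)" if t: "t \<in> cone_times A n" for t
    proof -
      obtain G xs b where G: "input_graph G" "one_cycle n G \<or> two_cycles n G"
        "encodes xs G" "halts A (xs @ apex_records n) t b"
        using t unfolding cone_times_def by blast
      note inst = cycle_instance_cone[OF G(1,2)]
      have ug: "ugraph G" using G(1) by (simp add: input_graph_def)
      let ?D = "bidiam (cone n G)"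
      have D: "D0 + 1 \<le> ?D" using inst(4) elim by linarith
      have "?D \<le> card (verts (cone n G))" using inst(1) by (intro bidiam_le_card(1)) auto
      also have "\<dots> = n + 1" using inst(1) by simp
      also have "n + 1 \<le> 2 * n" using elim by simp
      also have "\<dots> \<le> n ^ 2" using elim by (simp add: power2_eq_square)
      finally have Dn: "real ?D \<le> real n ^ 2" by (metis of_nat_le_iff of_nat_power)
      have "real t < c / 2 * ln (real ?D)"
      proof (rule D0)
        show "diameter (cone n G) \<le> d" by (rule order_trans[OF diameter_cone_le assms(1)])
        show "encodes (xs @ apex_records n) (cone n G)" using ug inst(1) G(3) by (rule encodes_cone)
      qed (use D G inst(1) input_graph_cone in auto)
      also have "\<dots> \<le> c / 2 * ln (real n ^ 2)"
      proof (rule mult_left_mono)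
        have "0 < real ?D" using D by simp
        then show "ln (real ?D) \<le> ln (real n ^ 2)" by (rule ln_mono[OF Dn])
      qed (use c in simp)
      also have "\<dots> = c * ln (real n)" using elim by (simp add: ln_realpow)
      finally show ?thesis by simp
    qed
    have "Max (insert 0 (cone_times A n)) \<in> insert 0 (cone_times A n)"
      using finite_cone_times by (intro Max_in) auto
    moreover have "0 \<le> ln (real n)" using elim by simp
    ultimately show ?case using bound c by auto
  qed
qed

lemma on_cone_distinguishes_cycles:
  assumes "2 \<le> d" "tests_biconnectivity d A"
  shows "distinguishes_cycles_in (on_cone A) (\<lambda>n. real (Max (insert 0 (cone_times A n))))"
  unfolding distinguishes_cycles_in_def
proof (intro allI impI, elim conjE)
  fix n G xs
  assume G: "input_graph G" "one_cycle n G \<or> two_cycles n G" "encodes xs G"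
  note inst = cycle_instance_cone[OF G(1,2)]
  have ug: "ugraph G" using G(1) by (simp add: input_graph_def)
  have "diameter (cone n G) \<le> d" by (rule order_trans[OF diameter_cone_le assms(1)])
  then have "\<exists>t. halts A (xs @ apex_records n) t (biconnected (cone n G))"
    using assms(2) encodes_cone[OF ug inst(1) G(3)] input_graph_cone[OF G(1) inst(1)]
    unfolding tests_biconnectivity_def by blast
  then obtain t where t: "halts A (xs @ apex_records n) t (one_cycle n G)"
    unfolding inst(3) ..
  moreover have "length xs = 4 * n" using encodes_length[OF ug G(3)] inst(1,2) by simp
  ultimately have "halts (on_cone A) xs t (one_cycle n G)" by (intro halts_on_cone)
  moreover have "t \<in> cone_times A n" using G t unfolding cone_times_def by blast
  then have "t \<le> Max (insert 0 (cone_times A n))" using finite_cone_times by (intro Max_ge) auto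
  ultimately show "\<exists>t. halts (on_cone A) xs t (one_cycle n G) \<and>
      real t \<le> real (Max (insert 0 (cone_times A n)))" by auto
qed

text \<open>By contraposition: an \<open>A\<close> without the lower bound turns
  \<open>on_cone A\<close>, with the maximum over \<open>cone_times A n\<close> as time bound, into
  an algorithm that the assumption excludes. The bound \<open>2 \<le> d\<close> admits all cones as
  inputs of \<open>A\<close>.\<close>

theorem theorem4:
  fixes \<gamma> \<delta> :: real and d :: nat
  assumes "0 \<le> \<gamma>" and "0 < \<delta>" and "\<delta> < 1" and "2 \<le> d"
    and "\<not> (\<exists>B T. mpc_algorithm \<gamma> \<delta> B \<and> T \<in> o(\<lambda>n. ln (real n)) \<and>
              distinguishes_cycles_in B T)"
  shows "\<forall>A. mpc_algorithm \<gamma> \<delta> A \<and> tests_biconnectivity d A \<longrightarrow> requires_log_bidiam d A"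
  using assms(4,5) mpc_algorithm_on_cone cone_times_smallo on_cone_distinguishes_cycles by blast

end
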